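(* For all $\varphi,\psi\in\mathsf{Form}$: $$\{\varphi\}\vdash_{\mathsf F}\psi \iff \varphi^{\mathrm I}\vdash_{\mathsf{OS4}}\psi^{\mathrm I}.$$
   Context: **Source language.** $\mathsf{Prop}$ is a countable set of propositional variables; $\mathsf{Form}$ is generated by $\varphi::=p\mid\bot\mid\top\mid(\varphi\wedge\varphi)\mid(\varphi\vee\varphi)\mid(\varphi\to\varphi)$, $p\in\mathsf{Prop}$, and $\neg\alpha:=\alpha\to\bot$. **System $\mathsf F$.** $\vdash_{\mathsf F}$ is the smallest relation ${\vdash}\subseteq\wp(\mathsf{Form})\times\mathsf{Form}$ satisfying the following for all $\Gamma,\Delta\subseteq\mathsf{Form}$ and $\alpha,\alpha',\beta,\varphi,\psi\in\mathsf{Form}$ (where $\Gamma,\varphi\vdash\psi$ means $\Gamma\cup\{\varphi\}\vdash\psi$, $\varphi\vdash\psi$ means $\{\varphi\}\vdash\psi$, $\vdash\varphi$ means $\varnothing\vdash\varphi$, and $\alpha\dashv\vdash\beta$ means $\alpha\vdash\beta$ and $\beta\vdash\alpha$): (A) $\Gamma,\varphi\vdash\varphi$; (Cut) if $\Gamma,\psi\vdash\varphi$ and $\Delta\vdash\psi$ then $\Gamma\cup\Delta\vdash\varphi$; ($\wedge$I) $\{\varphi,\psi\}\vdash\varphi\wedge\psi$; ($\wedge$E) $\varphi\wedge\psi\vdash\varphi$ and $\varphi\wedge\psi\vdash\psi$; ($\vee$I) $\varphi\vdash\varphi\vee\psi$ and $\psi\vdash\varphi\vee\psi$; ($\vee$E)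 if $\varphi\vdash\alpha$ and $\psi\vdash\alpha$ then $\varphi\vee\psi\vdash\alpha$; ($\bot$E) $\bot\vdash\varphi$; ($\top$) $\vdash\top$; ($\top\to$E) $\top\to\varphi\vdash\varphi$; (Con) if $\alpha\wedge\beta\vdash\psi$ then $\alpha\to\beta\vdash\alpha\to\psi$; ($\wedge{\vdash}\to$) $\alpha\wedge\beta\vdash\alpha\to\beta$; (Imp) if $\alpha\wedge\beta\vdash\varphi$ then $\varphi\to(\alpha\to\beta)\vdash(\varphi\wedge\alpha)\to\beta$; (Rep) if $\alpha\dashv\vdash\alpha'$ then $\alpha\to\beta\dashv\vdash\alpha'\to\beta$; ($\to$Id) $\vdash\alpha\to\alpha$; (Exp) $\{\alpha,\neg\alpha\}\vdash\bot$; ($\neg\neg$I) $\alpha\vdash\neg\neg\alpha$. **Target logic ortho-S4.** $\mathcal L_\Box$ is generated by $\varphi::=\top\mid p\mid\neg\varphi\mid(\varphi\wedge\varphi)\mid(\varphi\vee\varphi)\mid\Box\varphi$ ($\neg$ primitive), with $\bot:=\neg\top$. $\vdash_{\mathsf{OS4}}$ is the smallest binary relation on $\mathcal L_\Box$ such that for all $\varphi,\psi,\chi$: (o1) $\varphi\vdash\varphi$; $\varphi\vdash\top$; if $\varphi\vdash\psi$ and $\psi\vdash\chi$ then $\varphi\vdash\chi$; (o2) $\varphi\wedge\psi\vdash\varphi$; $\varphi\wedge\psi\vdash\psi$; if $\varphi\vdash\psi$ and $\varphi\vdash\chi$ then $\varphi\vdash\psi\wedge\chi$; (o3) $\varphi\vdash\varphi\vee\psi$;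 $\psi\vdash\varphi\vee\psi$; if $\varphi\vdash\chi$ and $\psi\vdash\chi$ then $\varphi\vee\psi\vdash\chi$; (o4) $\varphi\vdash\neg\neg\varphi$; $\neg\neg\varphi\vdash\varphi$; $\varphi\wedge\neg\varphi\vdash\psi$; if $\varphi\vdash\psi$ then $\neg\psi\vdash\neg\varphi$; (o5) if $\varphi\vdash\psi$ then $\Box\varphi\vdash\Box\psi$; $\Box\varphi\wedge\Box\psi\vdash\Box(\varphi\wedge\psi)$; $\top\vdash\Box\top$; (o6) $\Box\varphi\vdash\varphi$; $\Box\varphi\vdash\Box\Box\varphi$. **Translation.** $(\cdot)^{\mathrm I}:\mathsf{Form}\to\mathcal L_\Box$ is defined by $\bot^{\mathrm I}=\bot$, $\top^{\mathrm I}=\top$, $p^{\mathrm I}=\Box p$, $(\alpha\wedge\beta)^{\mathrm I}=\alpha^{\mathrm I}\wedge\beta^{\mathrm I}$, $(\alpha\vee\beta)^{\mathrm I}=\alpha^{\mathrm I}\vee\beta^{\mathrm I}$, and $(\alpha\to\beta)^{\mathrm I}=\Box\neg\bigl(\alpha^{\mathrm I}\wedge\neg(\alpha^{\mathrm I}\wedge\beta^{\mathrm I})\bigr)$. *)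

theory Defs
  imports Main "HOL-Library.Countable"
begin

datatype 'p form =
    Var 'p
  | Fls
  | Tru
  | And "'p form" "'p form" (infixr "\<^bold>\<and>" 70)
  | Or "'p form" "'p form" (infixr "\<^bold>\<or>" 65)
  | Imp "'p form" "'p form" (infixr "\<^bold>\<rightarrow>" 60)

abbreviation Neg :: "'p form \<Rightarrow> 'p form" ("\<^bold>\<not> _" [80] 80)
  where "\<^bold>\<not> \<alpha> \<equiv> \<alpha> \<^bold>\<rightarrow> Fls"

text \<open>Sets of premises are arbitrary, possibly infinite. Only the rules \<open>A\<close> and \<open>Cut\<close>
  mention arbitrary contexts; all others, in particular \<open>OrE\<close>, have no side premises.\<close>

inductive F_derives :: "'p form set \<Rightarrow> 'p form \<Rightarrow> bool" (infix "\<turnstile>\<^sub>F" 50)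
where
  A: "insert \<phi> \<Gamma> \<turnstile>\<^sub>F \<phi>"
| Cut: "insert \<psi> \<Gamma> \<turnstile>\<^sub>F \<phi> \<Longrightarrow> \<Delta> \<turnstile>\<^sub>F \<psi> \<Longrightarrow> \<Gamma> \<union> \<Delta> \<turnstile>\<^sub>F \<phi>"
| AndI: "{\<phi>, \<psi>} \<turnstile>\<^sub>F \<phi> \<^bold>\<and> \<psi>"
| AndE1: "{\<phi> \<^bold>\<and> \<psi>} \<turnstile>\<^sub>F \<phi>"
| AndE2: "{\<phi> \<^bold>\<and> \<psi>} \<turnstile>\<^sub>F \<psi>"
| OrI1: "{\<phi>} \<turnstile>\<^sub>F \<phi> \<^bold>\<or> \<psi>"
| OrI2: "{\<psi>} \<turnstile>\<^sub>F \<phi> \<^bold>\<or> \<psi>"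
| OrE: "{\<phi>} \<turnstile>\<^sub>F \<alpha> \<Longrightarrow> {\<psi>} \<turnstile>\<^sub>F \<alpha> \<Longrightarrow> {\<phi> \<^bold>\<or> \<psi>} \<turnstile>\<^sub>F \<alpha>"
| FlsE: "{Fls} \<turnstile>\<^sub>F \<phi>"
| TruI: "{} \<turnstile>\<^sub>F Tru"
| TruImpE: "{Tru \<^bold>\<rightarrow> \<phi>} \<turnstile>\<^sub>F \<phi>"
| Con: "{\<alpha> \<^bold>\<and> \<beta>} \<turnstile>\<^sub>F \<psi> \<Longrightarrow> {\<alpha> \<^bold>\<rightarrow> \<beta>} \<turnstile>\<^sub>F \<alpha> \<^bold>\<rightarrow> \<psi>"
| AndImp: "{\<alpha> \<^bold>\<and> \<beta>} \<turnstile>\<^sub>F \<alpha> \<^bold>\<rightarrow> \<beta>"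
| Import: "{\<alpha> \<^bold>\<and> \<beta>} \<turnstile>\<^sub>F \<phi> \<Longrightarrow> {\<phi> \<^bold>\<rightarrow> (\<alpha> \<^bold>\<rightarrow> \<beta>)} \<turnstile>\<^sub>F (\<phi> \<^bold>\<and> \<alpha>) \<^bold>\<rightarrow> \<beta>"
| Rep1: "{\<alpha>} \<turnstile>\<^sub>F \<alpha>' \<Longrightarrow> {\<alpha>'} \<turnstile>\<^sub>F \<alpha> \<Longrightarrow> {\<alpha> \<^bold>\<rightarrow> \<beta>} \<turnstile>\<^sub>F \<alpha>' \<^bold>\<rightarrow> \<beta>"
| Rep2: "{\<alpha>} \<turnstile>\<^sub>F \<alpha>' \<Longrightarrow> {\<alpha>'} \<turnstile>\<^sub>F \<alpha> \<Longrightarrow> {\<alpha>' \<^bold>\<rightarrow> \<beta>} \<turnstile>\<^sub>F \<alpha> \<^bold>\<rightarrow> \<beta>"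
| ImpId: "{} \<turnstile>\<^sub>F \<alpha> \<^bold>\<rightarrow> \<alpha>"
| Exp: "{\<alpha>, \<^bold>\<not> \<alpha>} \<turnstile>\<^sub>F Fls"
| NegNegI: "{\<alpha>} \<turnstile>\<^sub>F \<^bold>\<not> (\<^bold>\<not> \<alpha>)"

datatype 'p mform =
    MTru
  | MVar 'p
  | MNeg "'p mform" ("\<sim> _" [80] 80)
  | MAnd "'p mform" "'p mform" (infixr "\<sqinter>" 70)
  | MOr "'p mform" "'p mform" (infixr "\<squnion>" 65)
  | MBox "'p mform" ("\<box> _" [80] 80)

abbreviation MFls :: "'p mform"
  where "MFls \<equiv> \<sim> MTru"

inductive OS4_derives :: "'p mform \<Rightarrow> 'p mform \<Rightarrow> bool" (infix "\<turnstile>\<^sub>O\<^sub>S\<^sub>4" 50)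
where
  o1_refl: "\<phi> \<turnstile>\<^sub>O\<^sub>S\<^sub>4 \<phi>"
| o1_top: "\<phi> \<turnstile>\<^sub>O\<^sub>S\<^sub>4 MTru"
| o1_trans: "\<phi> \<turnstile>\<^sub>O\<^sub>S\<^sub>4 \<psi> \<Longrightarrow> \<psi> \<turnstile>\<^sub>O\<^sub>S\<^sub>4 \<chi> \<Longrightarrow> \<phi> \<turnstile>\<^sub>O\<^sub>S\<^sub>4 \<chi>"
| o2_E1: "\<phi> \<sqinter> \<psi> \<turnstile>\<^sub>O\<^sub>S\<^sub>4 \<phi>"
| o2_E2: "\<phi> \<sqinter> \<psi> \<turnstile>\<^sub>O\<^sub>S\<^sub>4 \<psi>"
| o2_I: "\<phi> \<turnstile>\<^sub>O\<^sub>S\<^sub>4 \<psi> \<Longrightarrow> \<phi> \<turnstile>\<^sub>O\<^sub>S\<^sub>4 \<chi> \<Longrightarrow> \<phi> \<turnstile>\<^sub>O\<^sub>S\<^sub>4 \<psi> \<sqinter> \<chi>"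
| o3_I1: "\<phi> \<turnstile>\<^sub>O\<^sub>S\<^sub>4 \<phi> \<squnion> \<psi>"
| o3_I2: "\<psi> \<turnstile>\<^sub>O\<^sub>S\<^sub>4 \<phi> \<squnion> \<psi>"
| o3_E: "\<phi> \<turnstile>\<^sub>O\<^sub>S\<^sub>4 \<chi> \<Longrightarrow> \<psi> \<turnstile>\<^sub>O\<^sub>S\<^sub>4 \<chi> \<Longrightarrow> \<phi> \<squnion> \<psi> \<turnstile>\<^sub>O\<^sub>S\<^sub>4 \<chi>"
| o4_dnI: "\<phi> \<turnstile>\<^sub>O\<^sub>S\<^sub>4 \<sim> (\<sim> \<phi>)"
| o4_dnE: "\<sim> (\<sim> \<phi>) \<turnstile>\<^sub>O\<^sub>S\<^sub>4 \<phi>"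
| o4_exp: "\<phi> \<sqinter> \<sim> \<phi> \<turnstile>\<^sub>O\<^sub>S\<^sub>4 \<psi>"
| o4_contra: "\<phi> \<turnstile>\<^sub>O\<^sub>S\<^sub>4 \<psi> \<Longrightarrow> \<sim> \<psi> \<turnstile>\<^sub>O\<^sub>S\<^sub>4 \<sim> \<phi>"
| o5_mono: "\<phi> \<turnstile>\<^sub>O\<^sub>S\<^sub>4 \<psi> \<Longrightarrow> \<box> \<phi> \<turnstile>\<^sub>O\<^sub>S\<^sub>4 \<box> \<psi>"
| o5_and: "\<box> \<phi> \<sqinter> \<box> \<psi> \<turnstile>\<^sub>O\<^sub>S\<^sub>4 \<box> (\<phi> \<sqinter> \<psi>)"
| o5_top: "MTru \<turnstile>\<^sub>O\<^sub>S\<^sub>4 \<box> MTru"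
| o6_T: "\<box> \<phi> \<turnstile>\<^sub>O\<^sub>S\<^sub>4 \<phi>"
| o6_4: "\<box> \<phi> \<turnstile>\<^sub>O\<^sub>S\<^sub>4 \<box> (\<box> \<phi>)"

primrec trI :: "'p form \<Rightarrow> 'p mform"
where
  "trI (Var p) = \<box> (MVar p)"
| "trI Fls = MFls"
| "trI Tru = MTru"
| "trI (\<alpha> \<^bold>\<and> \<beta>) = trI \<alpha> \<sqinter> trI \<beta>"
| "trI (\<alpha> \<^bold>\<or> \<beta>) = trI \<alpha> \<squnion> trI \<beta>"
| "trI (\<alpha> \<^bold>\<rightarrow> \<beta>) = \<box> (\<sim> (trI \<alpha> \<sqinter> \<sim> (trI \<alpha> \<sqinter> trI \<beta>)))"

end

theory Submission
  imports Defs
begin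

text \<open>
  Soundness of the translation is a computation in ortholattices with an interior operator: every
  \<open>trI \<alpha>\<close> is open, i.e. equivalent to its own box (\<open>trI_open\<close>), and for open \<open>a\<close>, \<open>b\<close> the boxed
  Sasaki hook \<open>\<box>\<not>(a \<and> \<not>(a \<and> b))\<close> satisfies all rules that \<open>F\<close> has for the conditional. Premise
  sets are handled by reading \<open>\<Gamma> \<turnstile> \<phi>\<close> as: whatever entails all members of \<open>\<Gamma>\<close> entails \<open>\<phi>\<close>.

  For faithfulness, one model refutes all underivable entailments at once. Write \<open>a \<preceq> b\<close> for
  \<open>{a} \<turnstile>\<^sub>F b\<close>. The worlds are pairs \<open>(c, y)\<close>, thought of as accepting exactly what follows from \<open>c\<close>
  and rejecting exactly what entails the conditional \<open>c \<rightarrow> y\<close>; no world may reject what it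
  accepts, so \<open>c \<preceq> c \<rightarrow> y\<close> is excluded. Two worlds are compatible if neither rejects the
  antecedent \<open>c\<close> of the other, and a world sees those whose antecedent is stronger. Compatibility
  is symmetric by definition and reflexive by the choice of worlds, so it induces a
  complement operation under which the sets equal to their double complement form an ortholattice.

  Everything rests on one fact (\<open>compat_extends\<close>): a formula \<open>a\<close> that the world \<open>w\<close> does not reject
  is itself the antecedent of a world compatible with \<open>w\<close>, namely \<open>(a, \<bottom>)\<close>. Hence a world
  satisfies the orthocomplement of the set of worlds accepting \<open>a\<close> iff it rejects \<open>a\<close>. So the
  translation of \<open>a \<rightarrow> b\<close> holds at a world with antecedent \<open>c\<close> iff \<open>c\<close> is rejected by every world
  \<open>(x, y)\<close> with \<open>x \<preceq> a\<close> that rejects \<open>a \<and> b\<close>. Unless \<open>(a, b)\<close> is excluded, in which case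
  \<open>a \<rightarrow> b\<close> is a theorem (\<open>self_imp_valid\<close>), it is one of these worlds, which gives
  \<open>c \<preceq> a \<rightarrow> b\<close>; conversely \<open>x \<preceq> a\<close> and \<open>a \<and> b \<preceq> x \<rightarrow> y\<close> imply
  \<open>a \<rightarrow> b \<preceq> a \<rightarrow> (x \<rightarrow> y) \<preceq> x \<rightarrow> y\<close> (\<open>imp_le_imp\<close>). The result is that the translation of \<open>\<phi>\<close> holds
  at \<open>(c, y)\<close> iff \<open>c \<preceq> \<phi>\<close> (\<open>truth_lemma\<close>).
\<close>

section \<open>The translation preserves derivability\<close>

lemma OS4_and_mono:
  "\<phi> \<turnstile>\<^sub>O\<^sub>S\<^sub>4 \<phi>' \<Longrightarrow> \<psi> \<turnstile>\<^sub>O\<^sub>S\<^sub>4 \<psi>' \<Longrightarrow> \<phi> \<sqinter> \<psi> \<turnstile>\<^sub>O\<^sub>S\<^sub>4 \<phi>' \<sqinter> \<psi>'"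
  by (meson o1_trans o2_E1 o2_E2 o2_I)

lemma OS4_contra': "\<phi> \<turnstile>\<^sub>O\<^sub>S\<^sub>4 \<sim> \<psi> \<Longrightarrow> \<psi> \<turnstile>\<^sub>O\<^sub>S\<^sub>4 \<sim> \<phi>"
  by (meson o1_trans o4_contra o4_dnI)

lemma OS4_from_MFls: "MFls \<turnstile>\<^sub>O\<^sub>S\<^sub>4 \<phi>"
  by (meson o1_refl o1_top o1_trans o2_I o4_exp)

lemma trI_open: "trI \<alpha> \<turnstile>\<^sub>O\<^sub>S\<^sub>4 \<box> (trI \<alpha>)"
proof (induction \<alpha>)
  case (Var p)
  then show ?case by (simp add: o6_4)
next
  case Fls
  then show ?case by (simp add: OS4_from_MFls)
next
  case Tru
  then show ?case by (simp add: o5_top)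
next
  case (And \<alpha> \<beta>)
  then show ?case by simp (meson OS4_and_mono o1_trans o5_and)
next
  case (Or \<alpha> \<beta>)
  then show ?case by simp (meson o1_trans o3_E o3_I1 o3_I2 o5_mono)
next
  case (Imp \<alpha> \<beta>)
  then show ?case by (simp add: o6_4)
qed

lemma OS4_box_intro: "trI \<alpha> \<turnstile>\<^sub>O\<^sub>S\<^sub>4 \<phi> \<Longrightarrow> trI \<alpha> \<turnstile>\<^sub>O\<^sub>S\<^sub>4 \<box> \<phi>"
  by (meson o1_trans o5_mono trI_open)

definition sasaki :: "'p mform \<Rightarrow> 'p mform \<Rightarrow> 'p mform"
  where "sasaki a b = \<sim> (a \<sqinter> \<sim> (a \<sqinter> b))"

lemma sasaki_above_neg: "\<sim> a \<turnstile>\<^sub>O\<^sub>S\<^sub>4 sasaki a b"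
  unfolding sasaki_def by (meson o2_E1 o4_contra)

lemma sasaki_above_and: "a \<sqinter> b \<turnstile>\<^sub>O\<^sub>S\<^sub>4 sasaki a b"
  unfolding sasaki_def by (meson OS4_contra' o2_E2)

text \<open>The Sasaki hook is the join of \<open>\<not>a\<close> and \<open>a \<and> b\<close>; this is the elimination half.\<close>

lemma sasaki_least:
  assumes "\<sim> a \<turnstile>\<^sub>O\<^sub>S\<^sub>4 x" and "a \<sqinter> b \<turnstile>\<^sub>O\<^sub>S\<^sub>4 x"
  shows "sasaki a b \<turnstile>\<^sub>O\<^sub>S\<^sub>4 x"
proof -
  have "\<sim> x \<turnstile>\<^sub>O\<^sub>S\<^sub>4 a"
    using assms(1) by (meson o1_trans o4_contra o4_dnE)
  moreover have "\<sim> x \<turnstile>\<^sub>O\<^sub>S\<^sub>4 \<sim> (a \<sqinter> b)"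
    using assms(2) by (rule o4_contra)
  ultimately have "\<sim> x \<turnstile>\<^sub>O\<^sub>S\<^sub>4 a \<sqinter> \<sim> (a \<sqinter> b)"
    by (rule o2_I)
  then show ?thesis
    unfolding sasaki_def by (meson o1_trans o4_contra o4_dnE)
qed

lemma trI_imp: "trI (\<alpha> \<^bold>\<rightarrow> \<beta>) = \<box> (sasaki (trI \<alpha>) (trI \<beta>))"
  by (simp add: sasaki_def)

lemma neg_sasaki_MFls: "sasaki a MFls \<turnstile>\<^sub>O\<^sub>S\<^sub>4 \<sim> a"
  by (meson OS4_from_MFls o1_refl o1_trans o2_E2 sasaki_least)

lemma sasaki_antecedent:
  assumes "a \<turnstile>\<^sub>O\<^sub>S\<^sub>4 a'" and "a' \<turnstile>\<^sub>O\<^sub>S\<^sub>4 a"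
  shows "sasaki a b \<turnstile>\<^sub>O\<^sub>S\<^sub>4 sasaki a' b"
  using assms
  by (meson OS4_and_mono o1_refl o1_trans o4_contra sasaki_above_and sasaki_above_neg sasaki_least)

text \<open>
  The hypothesis \<open>a \<and> b \<le> c\<close> is what turns \<open>a \<and> b\<close> into a part of \<open>(c \<and> a) \<and> b\<close>: the premise
  lies below \<open>\<not>c \<or> \<not>a \<or> (a \<and> b)\<close>, the conclusion is \<open>\<not>(c \<and> a) \<or> ((c \<and> a) \<and> b)\<close>.
\<close>

lemma sasaki_import:
  assumes "a \<sqinter> b \<turnstile>\<^sub>O\<^sub>S\<^sub>4 c"
  shows "sasaki c (\<box> (sasaki a b)) \<turnstile>\<^sub>O\<^sub>S\<^sub>4 sasaki (c \<sqinter> a) b"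
proof (rule sasaki_least)
  show "\<sim> c \<turnstile>\<^sub>O\<^sub>S\<^sub>4 sasaki (c \<sqinter> a) b"
    by (meson o1_trans o2_E1 o4_contra sasaki_above_neg)
  have "sasaki a b \<turnstile>\<^sub>O\<^sub>S\<^sub>4 sasaki (c \<sqinter> a) b"
  proof (rule sasaki_least)
    show "\<sim> a \<turnstile>\<^sub>O\<^sub>S\<^sub>4 sasaki (c \<sqinter> a) b"
      by (meson o1_trans o2_E2 o4_contra sasaki_above_neg)
    have "a \<sqinter> b \<turnstile>\<^sub>O\<^sub>S\<^sub>4 (c \<sqinter> a) \<sqinter> b"
      using assms by (meson o2_E1 o2_E2 o2_I)
    then show "a \<sqinter> b \<turnstile>\<^sub>O\<^sub>S\<^sub>4 sasaki (c \<sqinter> a) b"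
      by (meson o1_trans sasaki_above_and)
  qed
  then show "c \<sqinter> \<box> (sasaki a b) \<turnstile>\<^sub>O\<^sub>S\<^sub>4 sasaki (c \<sqinter> a) b"
    by (meson o1_trans o2_E2 o6_T)
qed

lemma sasaki_self: "\<phi> \<turnstile>\<^sub>O\<^sub>S\<^sub>4 sasaki a a"
proof -
  have "a \<sqinter> \<sim> (a \<sqinter> a) \<turnstile>\<^sub>O\<^sub>S\<^sub>4 a \<sqinter> \<sim> a"
    by (meson OS4_and_mono o1_refl o2_I o4_contra)
  then have "a \<sqinter> \<sim> (a \<sqinter> a) \<turnstile>\<^sub>O\<^sub>S\<^sub>4 \<sim> \<phi>"
    by (meson o1_trans o4_exp)
  then show ?thesis
    unfolding sasaki_def by (rule OS4_contra')
qed

text \<open>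
  Since no rule of \<open>F\<close> for the connectives has side premises, it is enough to interpret a premise
  set by its common lower bounds \<open>\<chi>\<close>; infinite sets then need no special care.
\<close>

lemma trI_sound:
  assumes "\<Gamma> \<turnstile>\<^sub>F \<phi>" and "\<And>\<gamma>. \<gamma> \<in> \<Gamma> \<Longrightarrow> \<chi> \<turnstile>\<^sub>O\<^sub>S\<^sub>4 trI \<gamma>"
  shows "\<chi> \<turnstile>\<^sub>O\<^sub>S\<^sub>4 trI \<phi>"
  using assms
proof (induction arbitrary: \<chi> rule: F_derives.induct)
  case (A \<phi> \<Gamma>)
  then show ?case by simp
next
  case (Cut \<psi> \<Gamma> \<phi> \<Delta>)
  then show ?case by (metis UnCI insert_iff)
next
  case (AndI \<phi> \<psi>)
  then show ?case by (simp add: o2_I)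
next
  case (AndE1 \<phi> \<psi>)
  then show ?case by simp (meson o1_trans o2_E1)
next
  case (AndE2 \<phi> \<psi>)
  then show ?case by simp (meson o1_trans o2_E2)
next
  case (OrI1 \<phi> \<psi>)
  then show ?case by simp (meson o1_trans o3_I1)
next
  case (OrI2 \<psi> \<phi>)
  then show ?case by simp (meson o1_trans o3_I2)
next
  case (OrE \<phi> \<alpha> \<psi>)
  have "trI \<phi> \<squnion> trI \<psi> \<turnstile>\<^sub>O\<^sub>S\<^sub>4 trI \<alpha>"
    by (rule o3_E) (use OrE.IH in \<open>auto intro: o1_refl\<close>)
  then show ?case using OrE.prems by simp (meson o1_trans)
next
  case (FlsE \<phi>)
  then show ?case by simp (meson OS4_from_MFls o1_trans)
next
  case TruI
  then show ?case by (simp add: o1_top)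
next
  case (TruImpE \<phi>)
  have "sasaki MTru (trI \<phi>) \<turnstile>\<^sub>O\<^sub>S\<^sub>4 trI \<phi>"
    by (rule sasaki_least) (rule OS4_from_MFls o2_E2)+
  then show ?case
    using TruImpE by (simp add: trI_imp del: trI.simps(6)) (meson o1_trans o6_T)
next
  case (Con \<alpha> \<beta> \<psi>)
  have "trI \<alpha> \<sqinter> trI \<beta> \<turnstile>\<^sub>O\<^sub>S\<^sub>4 trI \<psi>"
    using Con.IH[of "trI \<alpha> \<sqinter> trI \<beta>"] by (simp add: o1_refl)
  then have "sasaki (trI \<alpha>) (trI \<beta>) \<turnstile>\<^sub>O\<^sub>S\<^sub>4 sasaki (trI \<alpha>) (trI \<psi>)"
    by (meson o1_trans o2_E1 o2_I sasaki_above_and sasaki_above_neg sasaki_least)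
  then show ?case
    using Con.prems by (simp add: trI_imp del: trI.simps(6)) (meson o1_trans o5_mono)
next
  case (AndImp \<alpha> \<beta>)
  have "trI (\<alpha> \<^bold>\<and> \<beta>) \<turnstile>\<^sub>O\<^sub>S\<^sub>4 \<box> (sasaki (trI \<alpha>) (trI \<beta>))"
    by (rule OS4_box_intro) (simp add: sasaki_above_and)
  then show ?case using AndImp trI_imp by (metis o1_trans singletonI)
next
  case (Import \<alpha> \<beta> \<phi>)
  have "trI \<alpha> \<sqinter> trI \<beta> \<turnstile>\<^sub>O\<^sub>S\<^sub>4 trI \<phi>"
    using Import.IH[of "trI \<alpha> \<sqinter> trI \<beta>"] by (simp add: o1_refl)
  from sasaki_import[OF this] show ?case
    using Import.prems by (simp add: trI_imp del: trI.simps(6)) (meson o1_trans o5_mono)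
next
  case (Rep1 \<alpha> \<alpha>' \<beta>)
  have "trI \<alpha> \<turnstile>\<^sub>O\<^sub>S\<^sub>4 trI \<alpha>'" "trI \<alpha>' \<turnstile>\<^sub>O\<^sub>S\<^sub>4 trI \<alpha>"
    using Rep1.IH by (auto intro: o1_refl)
  from sasaki_antecedent[OF this] show ?case
    using Rep1.prems by (simp add: trI_imp del: trI.simps(6)) (meson o1_trans o5_mono)
next
  case (Rep2 \<alpha> \<alpha>' \<beta>)
  have "trI \<alpha>' \<turnstile>\<^sub>O\<^sub>S\<^sub>4 trI \<alpha>" "trI \<alpha> \<turnstile>\<^sub>O\<^sub>S\<^sub>4 trI \<alpha>'"
    using Rep2.IH by (auto intro: o1_refl)
  from sasaki_antecedent[OF this] show ?case
    using Rep2.prems by (simp add: trI_imp del: trI.simps(6)) (meson o1_trans o5_mono)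
next
  case (ImpId \<alpha>)
  have "\<chi> \<turnstile>\<^sub>O\<^sub>S\<^sub>4 \<box> MTru"
    by (meson o1_top o1_trans o5_top)
  then show ?case
    unfolding trI_imp by (meson o1_trans o5_mono sasaki_self)
next
  case (Exp \<alpha>)
  have "\<chi> \<turnstile>\<^sub>O\<^sub>S\<^sub>4 \<box> (sasaki (trI \<alpha>) MFls)"
    using Exp[of "\<alpha> \<^bold>\<rightarrow> Fls"] by (simp add: sasaki_def)
  then have "\<chi> \<turnstile>\<^sub>O\<^sub>S\<^sub>4 \<sim> (trI \<alpha>)"
    by (meson neg_sasaki_MFls o1_trans o6_T)
  moreover have "\<chi> \<turnstile>\<^sub>O\<^sub>S\<^sub>4 trI \<alpha>"
    using Exp[of \<alpha>] by simp
  ultimately show ?case by (meson o1_trans o2_I o4_exp)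
next
  case (NegNegI \<alpha>)
  have "\<box> (sasaki (trI \<alpha>) MFls) \<turnstile>\<^sub>O\<^sub>S\<^sub>4 \<sim> (trI \<alpha>)"
    by (meson neg_sasaki_MFls o1_trans o6_T)
  then have "trI \<alpha> \<turnstile>\<^sub>O\<^sub>S\<^sub>4 sasaki (\<box> (sasaki (trI \<alpha>) MFls)) MFls"
    by (meson OS4_contra' o1_trans sasaki_above_neg)
  then have "trI \<alpha> \<turnstile>\<^sub>O\<^sub>S\<^sub>4 trI (\<^bold>\<not> (\<^bold>\<not> \<alpha>))"
    by (simp add: OS4_box_intro trI_imp del: trI.simps(6))
  then show ?case using NegNegI by (meson o1_trans singletonI)
qed

section \<open>Kripke semantics for ortho-S4\<close>

text \<open>
  Let a world reach \<open>z\<close> if it sees a world compatible with \<open>z\<close>. \<open>interplay\<close> says that a world \<open>w\<close>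
  reaching \<open>z\<close> is compatible with some \<open>u\<close> whose compatible worlds all reach \<open>z\<close>. This keeps the box
  of a set \<open>P\<close> that is closed under double orthocomplement closed. For if \<open>w\<close> sees a world outside \<open>P\<close>,
  then, \<open>P\<close> being closed, \<open>w\<close> reaches a world \<open>z\<close> in the orthocomplement of \<open>P\<close>; no world that reaches
  \<open>z\<close> is in the box of \<open>P\<close>, so \<open>u\<close> is in its orthocomplement, and \<open>w\<close> is not in the double one.
\<close>

locale ortho_S4_frame =
  fixes worlds :: "'w set"
    and compat :: "'w \<Rightarrow> 'w \<Rightarrow> bool"
    and see :: "'w \<Rightarrow> 'w \<Rightarrow> bool"
  assumes compat_world: "compat w v \<Longrightarrow> w \<in> worlds"
    and compat_refl: "w \<in> worlds \<Longrightarrow> compat w w"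
    and compat_sym: "compat w v \<Longrightarrow> compat v w"
    and see_world: "see w v \<Longrightarrow> v \<in> worlds"
    and see_refl: "w \<in> worlds \<Longrightarrow> see w w"
    and see_trans: "see w v \<Longrightarrow> see v u \<Longrightarrow> see w u"
    and interplay: "w \<in> worlds \<Longrightarrow> see w v \<Longrightarrow> compat v z \<Longrightarrow>
      \<exists>u. compat w u \<and> (\<forall>r. compat u r \<longrightarrow> (\<exists>s. see r s \<and> compat s z))"
begin

primrec sat :: "('p \<Rightarrow> 'w set) \<Rightarrow> 'p mform \<Rightarrow> 'w \<Rightarrow> bool" where
  "sat V MTru w \<longleftrightarrow> True"
| "sat V (MVar p) w \<longleftrightarrow> w \<in> V p"
| "sat V (\<sim> \<phi>) w \<longleftrightarrow> (\<forall>v. compat w v \<longrightarrow> \<not> sat V \<phi> v)"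
| "sat V (\<phi> \<sqinter> \<psi>) w \<longleftrightarrow> sat V \<phi> w \<and> sat V \<psi> w"
| "sat V (\<phi> \<squnion> \<psi>) w \<longleftrightarrow> (\<forall>v. compat w v \<longrightarrow> (\<exists>u. compat v u \<and> (sat V \<phi> u \<or> sat V \<psi> u)))"
| "sat V (\<box> \<phi>) w \<longleftrightarrow> (\<forall>v. see w v \<longrightarrow> sat V \<phi> v)"

definition regular :: "('w \<Rightarrow> bool) \<Rightarrow> bool"
  where "regular P \<longleftrightarrow>
    (\<forall>w\<in>worlds. (\<forall>v. compat w v \<longrightarrow> (\<exists>u. compat v u \<and> P u)) \<longrightarrow> P w)"

lemma regularD:
  "regular P \<Longrightarrow> w \<in> worlds \<Longrightarrow> (\<And>v. compat w v \<Longrightarrow> \<exists>u. compat v u \<and> P u) \<Longrightarrow> P w"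
  unfolding regular_def by blast

lemma regular_orthocomplement: "regular (\<lambda>w. \<forall>v. compat w v \<longrightarrow> Q v)"
  unfolding regular_def using compat_sym by blast

lemma sat_regular:
  assumes "\<And>p. regular (\<lambda>w. w \<in> V p)"
  shows "regular (sat V \<phi>)"
proof (induction \<phi>)
  case MTru
  then show ?case by (simp add: regular_def)
next
  case (MVar p)
  then show ?case using assms by (simp add: regular_def)
next
  case (MNeg \<phi>)
  show ?case
    using regular_orthocomplement[of "\<lambda>v. \<not> sat V \<phi> v"] by (simp add: regular_def)
next
  case (MAnd \<phi> \<psi>)
  then show ?case unfolding regular_def by (metis sat.simps(4))
next
  case (MOr \<phi> \<psi>)
  show ?case
    using regular_orthocomplement[of "\<lambda>v. \<exists>u. compat v u \<and> (sat V \<phi> u \<or> sat V \<psi> u)"]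
    by (simp add: regular_def)
next
  case (MBox \<phi>)
  show ?case
    unfolding regular_def
  proof (intro ballI impI)
    fix w
    assume w: "w \<in> worlds" and dense: "\<forall>v. compat w v \<longrightarrow> (\<exists>u. compat v u \<and> sat V (\<box> \<phi>) u)"
    show "sat V (\<box> \<phi>) w"
    proof (simp, intro allI impI)
      fix v
      assume v: "see w v"
      show "sat V \<phi> v"
      proof (rule regularD[OF MBox.IH see_world[OF v]])
        fix z
        assume "compat v z"
        with w v interplay obtain u where u: "compat w u"
          "\<forall>r. compat u r \<longrightarrow> (\<exists>s. see r s \<and> compat s z)"
          by blast
        with dense obtain r where "compat u r" "sat V (\<box> \<phi>) r"
          by blast
        with u(2) show "\<exists>s. compat z s \<and> sat V \<phi> s"
          using compat_sym by (metis sat.simps(6))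
      qed
    qed
  qed
qed

lemma OS4_sound:
  assumes "\<phi> \<turnstile>\<^sub>O\<^sub>S\<^sub>4 \<psi>" and V: "\<And>p. regular (\<lambda>w. w \<in> V p)"
    and "w \<in> worlds" and "sat V \<phi> w"
  shows "sat V \<psi> w"
  using assms(1,3,4)
proof (induction arbitrary: w rule: OS4_derives.induct)
  case (o3_I1 \<phi> \<psi>)
  then show ?case using compat_sym by auto
next
  case (o3_I2 \<psi> \<phi>)
  then show ?case using compat_sym by auto
next
  case (o3_E \<phi> \<chi> \<psi>)
  show ?case
  proof (rule regularD[OF sat_regular[OF V] o3_E.prems(1)])
    fix v
    assume "compat w v"
    then obtain u where "compat v u" "sat V \<phi> u \<or> sat V \<psi> u"
      using o3_E.prems(2) by auto
    moreover have "u \<in> worlds"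
      using \<open>compat v u\<close> compat_sym compat_world by blast
    ultimately show "\<exists>u. compat v u \<and> sat V \<chi> u"
      using o3_E.IH by blast
  qed
next
  case (o4_dnI \<phi>)
  then show ?case using compat_sym by auto
next
  case (o4_dnE \<phi>)
  show ?case
    by (rule regularD[OF sat_regular[OF V] o4_dnE.prems(1)]) (use o4_dnE in auto)
next
  case (o4_exp \<phi> \<psi>)
  then show ?case using compat_refl by auto
next
  case (o4_contra \<phi> \<psi>)
  then show ?case using compat_world compat_sym by (metis sat.simps(3))
next
  case (o5_mono \<phi> \<psi>)
  then show ?case using see_world by auto
next
  case (o6_T \<phi>)
  then show ?case using see_refl by auto
next
  case (o6_4 \<phi>)
  then show ?case using see_trans by auto
qed auto

end

section \<open>Entailment between single formulas in F\<close>

abbreviation F_le :: "'p form \<Rightarrow> 'p form \<Rightarrow> bool" (infix "\<preceq>" 50)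
  where "\<alpha> \<preceq> \<beta> \<equiv> {\<alpha>} \<turnstile>\<^sub>F \<beta>"

lemma F_refl: "\<alpha> \<preceq> \<alpha>"
  by (rule F_derives.A)

lemma F_trans: "\<alpha> \<preceq> \<beta> \<Longrightarrow> \<beta> \<preceq> \<gamma> \<Longrightarrow> \<alpha> \<preceq> \<gamma>"
  using F_derives.Cut[of \<beta> "{}" \<gamma> "{\<alpha>}"] by simp

lemma F_pair:
  assumes "{\<beta>, \<gamma>} \<turnstile>\<^sub>F \<delta>" and "\<alpha> \<preceq> \<beta>" and "\<alpha> \<preceq> \<gamma>"
  shows "\<alpha> \<preceq> \<delta>"
proof -
  have "insert \<gamma> {\<alpha>} \<turnstile>\<^sub>F \<delta>"
    using F_derives.Cut[OF assms(1,2)] by (simp add: insert_commute)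
  from F_derives.Cut[OF this assms(3)] show ?thesis by simp
qed

lemma F_and_iff: "\<alpha> \<preceq> \<beta> \<^bold>\<and> \<gamma> \<longleftrightarrow> \<alpha> \<preceq> \<beta> \<and> \<alpha> \<preceq> \<gamma>"
  by (meson F_pair F_trans F_derives.AndI F_derives.AndE1 F_derives.AndE2)

lemma F_or_iff: "\<alpha> \<^bold>\<or> \<beta> \<preceq> \<gamma> \<longleftrightarrow> \<alpha> \<preceq> \<gamma> \<and> \<beta> \<preceq> \<gamma>"
  by (meson F_trans F_derives.OrI1 F_derives.OrI2 F_derives.OrE)

lemma F_weaken: "{} \<turnstile>\<^sub>F \<beta> \<Longrightarrow> \<alpha> \<preceq> \<beta>"
  using F_derives.Cut[of \<beta> "{\<alpha>}" \<beta> "{}"] F_derives.A[of \<beta> "{\<alpha>}"] by simp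

lemma F_Tru: "\<alpha> \<preceq> Tru"
  by (rule F_weaken) (rule F_derives.TruI)

lemma F_Fls: "\<alpha> \<preceq> Fls \<Longrightarrow> \<alpha> \<preceq> \<beta>"
  by (meson F_trans F_derives.FlsE)

lemma F_Tru_imp_iff: "\<alpha> \<preceq> Tru \<^bold>\<rightarrow> \<beta> \<longleftrightarrow> \<alpha> \<preceq> \<beta>"
  by (meson F_Tru F_and_iff F_refl F_trans F_derives.AndImp F_derives.TruImpE)

lemma F_and_right: "\<alpha> \<^bold>\<and> \<beta> \<preceq> \<beta>" and F_and_left: "\<alpha> \<^bold>\<and> \<beta> \<preceq> \<alpha>"
  by (rule F_derives.AndE2 F_derives.AndE1)+

text \<open>
  The rule \<open>Import\<close> is strong enough to discharge an outer antecedent weaker than the inner one: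
  \<open>a \<rightarrow> (x \<rightarrow> y)\<close> entails \<open>(a \<and> x) \<rightarrow> y\<close>, and \<open>a \<and> x\<close> is \<open>x\<close>.
\<close>

lemma imp_absorb:
  assumes "x \<preceq> a"
  shows "a \<^bold>\<rightarrow> (x \<^bold>\<rightarrow> y) \<preceq> x \<^bold>\<rightarrow> y"
proof -
  have "a \<^bold>\<rightarrow> (x \<^bold>\<rightarrow> y) \<preceq> (a \<^bold>\<and> x) \<^bold>\<rightarrow> y"
    by (rule F_derives.Import) (meson F_and_left F_trans assms)
  moreover have "(a \<^bold>\<and> x) \<^bold>\<rightarrow> y \<preceq> x \<^bold>\<rightarrow> y"
    by (rule F_derives.Rep1) (simp_all add: F_and_right F_and_iff F_refl assms)
  ultimately show ?thesis by (rule F_trans)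
qed

lemma imp_le_imp:
  assumes "x \<preceq> a" and "a \<^bold>\<and> b \<preceq> x \<^bold>\<rightarrow> y"
  shows "a \<^bold>\<rightarrow> b \<preceq> x \<^bold>\<rightarrow> y"
  using F_derives.Con[OF assms(2)] imp_absorb[OF assms(1)] by (rule F_trans)

text \<open>
  The pairs excluded from the worlds below: they are degenerate, in that they would reject
  everything. Here \<open>c\<close> entails \<open>c \<rightarrow> y\<close>, so \<open>c \<rightarrow> c\<close>, a theorem, entails \<open>c \<rightarrow> (c \<rightarrow> y)\<close>, and the two
  equal antecedents contract.
\<close>

lemma self_imp_valid:
  assumes "c \<preceq> c \<^bold>\<rightarrow> y"
  shows "z \<preceq> c \<^bold>\<rightarrow> y"
proof -
  have "c \<^bold>\<rightarrow> c \<preceq> c \<^bold>\<rightarrow> y"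
    by (rule imp_le_imp[OF F_refl]) (meson F_and_left F_trans assms)
  then show ?thesis by (meson F_trans F_weaken F_derives.ImpId)
qed

lemma neg_le_imp: "\<^bold>\<not> c \<preceq> c \<^bold>\<rightarrow> y"
  by (rule F_derives.Con) (meson F_and_right F_Fls)

lemma neg_swap:
  assumes "a \<preceq> \<^bold>\<not> b"
  shows "b \<preceq> \<^bold>\<not> a"
proof -
  have "\<^bold>\<not> (\<^bold>\<not> b) \<preceq> \<^bold>\<not> a"
    by (rule imp_le_imp[OF assms]) (meson F_and_right F_Fls)
  then show ?thesis by (meson F_trans F_derives.NegNegI)
qed

lemma self_neg_Fls: "a \<preceq> \<^bold>\<not> a \<Longrightarrow> a \<preceq> Fls"
  by (meson F_pair F_refl F_derives.Exp)

section \<open>The canonical frame\<close>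

type_synonym 'p world = "'p form \<times> 'p form"

abbreviation rejects :: "'p world \<Rightarrow> 'p form \<Rightarrow> bool"
  where "rejects w \<alpha> \<equiv> \<alpha> \<preceq> fst w \<^bold>\<rightarrow> snd w"

definition can_worlds :: "'p world set"
  where "can_worlds = {w. \<not> rejects w (fst w)}"

definition can_compat :: "'p world \<Rightarrow> 'p world \<Rightarrow> bool"
  where "can_compat w v \<longleftrightarrow>
    w \<in> can_worlds \<and> v \<in> can_worlds \<and> \<not> rejects w (fst v) \<and> \<not> rejects v (fst w)"

definition can_see :: "'p world \<Rightarrow> 'p world \<Rightarrow> bool"
  where "can_see w v \<longleftrightarrow> v \<in> can_worlds \<and> fst v \<preceq> fst w"

lemma can_see_le: "can_see w v \<Longrightarrow> fst v \<preceq> fst w"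
  by (simp add: can_see_def)

lemma rejects_mono: "\<alpha> \<preceq> \<beta> \<Longrightarrow> rejects w \<beta> \<Longrightarrow> rejects w \<alpha>"
  by (rule F_trans)

lemma can_worlds_Fls: "\<not> a \<preceq> Fls \<Longrightarrow> (a, Fls) \<in> can_worlds"
  by (auto simp: can_worlds_def dest: self_neg_Fls)

text \<open>
  If \<open>(a, \<bottom>)\<close> rejected \<open>fst w\<close>, then \<open>a\<close> would entail the negation of \<open>fst w\<close>, as negation is
  self-adjoint, and hence every conditional with antecedent \<open>fst w\<close>; so \<open>w\<close> would reject \<open>a\<close>.
\<close>

lemma compat_extends:
  assumes "w \<in> can_worlds" and "\<not> rejects w a"
  shows "can_compat w (a, Fls)"
proof -
  have "\<not> a \<preceq> Fls"
    using assms(2) F_Fls by blast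
  moreover have "\<not> rejects (a, Fls) (fst w)"
  proof
    assume "rejects (a, Fls) (fst w)"
    then have "a \<preceq> \<^bold>\<not> (fst w)"
      by (simp add: neg_swap)
    then show False
      using assms(2) neg_le_imp F_trans by blast
  qed
  ultimately show ?thesis
    using assms can_worlds_Fls by (simp add: can_compat_def)
qed

lemma rejects_iff:
  assumes "w \<in> can_worlds"
  shows "rejects w a \<longleftrightarrow> (\<forall>v. can_compat w v \<longrightarrow> \<not> fst v \<preceq> a)"
  using compat_extends[OF assms, of a] rejects_mono F_refl
  by (fastforce simp: can_compat_def)

text \<open>
  If \<open>a\<close> is not a theorem, then \<open>(\<top>, a)\<close> is a world that rejects exactly what entails \<open>a\<close>, and
  no world rejects its antecedent.
  It serves to separate any world not accepting \<open>a\<close> from all that do.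
\<close>

lemma compat_Tru_iff:
  "can_compat w (Tru, a) \<longleftrightarrow> w \<in> can_worlds \<and> \<not> fst w \<preceq> a"
proof -
  have "\<not> rejects w Tru" if "w \<in> can_worlds"
    using that F_Tru rejects_mono unfolding can_worlds_def by blast
  moreover have "(Tru, a) \<in> can_worlds" if "\<not> fst w \<preceq> a"
    using that F_Tru F_trans by (auto simp: can_worlds_def F_Tru_imp_iff)
  ultimately show ?thesis
    by (auto simp: can_compat_def F_Tru_imp_iff)
qed

lemma can_compat_world: "can_compat w v \<Longrightarrow> v \<in> can_worlds"
  by (simp add: can_compat_def)

lemma can_compat_sym: "can_compat w v \<Longrightarrow> can_compat v w"
  by (auto simp: can_compat_def)

interpretation canonical: ortho_S4_frame can_worlds can_compat can_see
proof
  fix w v z :: "'p world"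
  assume "w \<in> can_worlds" "can_see w v" "can_compat v z"
  then have z: "z \<in> can_worlds" and "\<not> rejects z (fst w)"
    using rejects_mono[of "fst v" "fst w" z] by (auto simp: can_see_def can_compat_def)
  \<comment> \<open>A world reaches \<open>z\<close> iff \<open>z\<close> does not reject its antecedent. The worlds compatible with the
    following \<open>?u\<close> are exactly these.\<close>
  let ?u = "(Tru, fst z \<^bold>\<rightarrow> snd z)"
  have "can_compat w ?u"
    using \<open>w \<in> can_worlds\<close> \<open>\<not> rejects z (fst w)\<close> by (simp add: compat_Tru_iff)
  moreover have "\<exists>s. can_see r s \<and> can_compat s z" if "can_compat ?u r" for r
  proof -
    have "\<not> rejects z (fst r)"
      using can_compat_sym[OF that] by (simp add: compat_Tru_iff)
    then have "can_compat z (fst r, Fls)"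
      by (rule compat_extends[OF z])
    then show ?thesis
      by (intro exI[of _ "(fst r, Fls)"]) (auto simp: can_see_def can_compat_def F_refl)
  qed
  ultimately show "\<exists>u. can_compat w u \<and>
      (\<forall>r. can_compat u r \<longrightarrow> (\<exists>s. can_see r s \<and> can_compat s z))"
    by blast
qed (auto simp: can_compat_def can_see_def can_worlds_def intro: F_refl F_trans)

definition can_val :: "'p \<Rightarrow> 'p world set"
  where "can_val p = {w. fst w \<preceq> Var p}"

lemma accepts_regular:
  fixes a :: "'p form"
  shows "canonical.regular (\<lambda>w. fst w \<preceq> a)"
  unfolding canonical.regular_def
proof (intro ballI impI)
  fix w :: "'p world"
  assume w: "w \<in> can_worlds" and dense: "\<forall>v. can_compat w v \<longrightarrow> (\<exists>u. can_compat v u \<and> fst u \<preceq> a)"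
  show "fst w \<preceq> a"
  proof (rule ccontr)
    assume "\<not> fst w \<preceq> a"
    with w dense obtain u where "can_compat (Tru, a) u" "fst u \<preceq> a"
      using compat_Tru_iff by blast
    then show False
      using can_compat_sym compat_Tru_iff by blast
  qed
qed

lemma truth_lemma:
  "w \<in> can_worlds \<Longrightarrow> canonical.sat can_val (trI \<phi>) w \<longleftrightarrow> fst w \<preceq> \<phi>"
proof (induction \<phi> arbitrary: w)
  case (Var p)
  have "canonical.sat can_val (trI (Var p)) w \<longleftrightarrow> (\<forall>v. can_see w v \<longrightarrow> fst v \<preceq> Var p)"
    by (simp add: can_val_def)
  also have "\<dots> \<longleftrightarrow> fst w \<preceq> Var p"
    using canonical.see_refl[OF Var] can_see_le F_trans by blast
  finally show ?case .
next
  case Fls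
  then have "can_compat w w" and "\<not> fst w \<preceq> Fls"
    using F_Fls by (auto simp: can_compat_def can_worlds_def)
  then show ?case using canonical.sat.simps(1,3) trI.simps(2) by metis
next
  case Tru
  then show ?case by (simp add: F_Tru)
next
  case (And \<alpha> \<beta>)
  then show ?case by (simp add: F_and_iff)
next
  case (Or \<alpha> \<beta>)
  have "canonical.sat can_val (trI (\<alpha> \<^bold>\<or> \<beta>)) w \<longleftrightarrow>
      (\<forall>v. can_compat w v \<longrightarrow> (\<exists>u. can_compat v u \<and> (fst u \<preceq> \<alpha> \<or> fst u \<preceq> \<beta>)))"
    unfolding trI.simps canonical.sat.simps using Or.IH can_compat_world by metis
  also have "\<dots> \<longleftrightarrow> (\<forall>v. can_compat w v \<longrightarrow> \<not> rejects v \<alpha> \<or> \<not> rejects v \<beta>)"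
    using rejects_iff by (metis can_compat_world)
  also have "\<dots> \<longleftrightarrow> (\<forall>v. can_compat w v \<longrightarrow> \<not> rejects v (\<alpha> \<^bold>\<or> \<beta>))"
    by (simp add: F_or_iff)
  also have "\<dots> \<longleftrightarrow> (\<forall>v. can_compat w v \<longrightarrow> (\<exists>u. can_compat v u \<and> fst u \<preceq> \<alpha> \<^bold>\<or> \<beta>))"
    using rejects_iff by (metis can_compat_world)
  also have "\<dots> \<longleftrightarrow> fst w \<preceq> \<alpha> \<^bold>\<or> \<beta>"
    using canonical.regularD[OF accepts_regular Or.prems] can_compat_sym by blast
  finally show ?case .
next
  case (Imp \<alpha> \<beta>)
  let ?hook = "\<sim> (trI \<alpha> \<sqinter> \<sim> (trI \<alpha> \<sqinter> trI \<beta>))"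
  have "canonical.sat can_val (\<sim> (trI \<alpha> \<sqinter> trI \<beta>)) u \<longleftrightarrow> rejects u (\<alpha> \<^bold>\<and> \<beta>)"
    if "u \<in> can_worlds" for u
    using Imp.IH can_compat_world
    unfolding rejects_iff[OF that] F_and_iff canonical.sat.simps(3,4) by blast
  then have hook: "canonical.sat can_val ?hook v \<longleftrightarrow>
      (\<forall>u. can_compat v u \<and> fst u \<preceq> \<alpha> \<longrightarrow> \<not> rejects u (\<alpha> \<^bold>\<and> \<beta>))" for v
    using Imp.IH(1) can_compat_world unfolding canonical.sat.simps(3,4) by blast
  show ?case
  proof
    assume sat: "canonical.sat can_val (trI (\<alpha> \<^bold>\<rightarrow> \<beta>)) w"
    show "fst w \<preceq> \<alpha> \<^bold>\<rightarrow> \<beta>"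
    proof (rule ccontr)
      assume not: "\<not> fst w \<preceq> \<alpha> \<^bold>\<rightarrow> \<beta>"
      then have "(\<alpha>, \<beta>) \<in> can_worlds"
        using self_imp_valid by (auto simp: can_worlds_def)
      with not have comp: "can_compat (\<alpha>, \<beta>) (fst w, Fls)"
        by (simp add: compat_extends)
      then have "can_see w (fst w, Fls)"
        by (simp add: can_see_def can_compat_def F_refl)
      with sat have "canonical.sat can_val ?hook (fst w, Fls)"
        by simp
      with can_compat_sym[OF comp] have "\<not> rejects (\<alpha>, \<beta>) (\<alpha> \<^bold>\<and> \<beta>)"
        unfolding hook by (simp add: F_refl)
      then show False by (simp add: F_derives.AndImp)
    qed
  next
    assume w: "fst w \<preceq> \<alpha> \<^bold>\<rightarrow> \<beta>"
    have "canonical.sat can_val ?hook v" if "can_see w v" for v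
      unfolding hook
    proof (intro allI impI notI)
      fix u
      assume u: "can_compat v u \<and> fst u \<preceq> \<alpha>" and "rejects u (\<alpha> \<^bold>\<and> \<beta>)"
      then have "rejects u (\<alpha> \<^bold>\<rightarrow> \<beta>)"
        using imp_le_imp by blast
      then have "rejects u (fst v)"
        using that w F_trans unfolding can_see_def by blast
      with u show False by (simp add: can_compat_def)
    qed
    then show "canonical.sat can_val (trI (\<alpha> \<^bold>\<rightarrow> \<beta>)) w"
      by simp
  qed
qed

lemma trI_faithful:
  assumes "trI \<phi> \<turnstile>\<^sub>O\<^sub>S\<^sub>4 trI \<psi>"
  shows "\<phi> \<preceq> \<psi>"
proof (cases "\<phi> \<preceq> Fls")
  case True
  then show ?thesis by (rule F_Fls)
next
  case False
  then have w: "(\<phi>, Fls) \<in> can_worlds"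
    by (rule can_worlds_Fls)
  have "canonical.sat can_val (trI \<psi>) (\<phi>, Fls)"
  proof (rule canonical.OS4_sound[OF assms _ w])
    show "canonical.regular (\<lambda>w. w \<in> can_val p)" for p
      using accepts_regular by (simp add: can_val_def)
    show "canonical.sat can_val (trI \<phi>) (\<phi>, Fls)"
      using truth_lemma[OF w] by (simp add: F_refl)
  qed
  then show ?thesis
    using truth_lemma[OF w] by simp
qed

theorem theorem8p14:
  fixes \<phi> \<psi> :: "'p::countable form"
  shows "{\<phi>} \<turnstile>\<^sub>F \<psi> \<longleftrightarrow> trI \<phi> \<turnstile>\<^sub>O\<^sub>S\<^sub>4 trI \<psi>"
proof
  assume "{\<phi>} \<turnstile>\<^sub>F \<psi>"
  then show "trI \<phi> \<turnstile>\<^sub>O\<^sub>S\<^sub>4 trI \<psi>"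
    by (rule trI_sound) (simp add: o1_refl)
next
  assume "trI \<phi> \<turnstile>\<^sub>O\<^sub>S\<^sub>4 trI \<psi>"
  then show "{\<phi>} \<turnstile>\<^sub>F \<psi>"
    by (rule trI_faithful)
qed

end
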